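(* We have $\mathcal{R}(1,1)=1$, and $\mathcal{R}(k,n)=0$ whenever $k<n$ or $k>\kappa(n)$. For $n\geq2$ and $n\leq k\leq\kappa(n)$, $$\mathcal{R}(k,n)=\sum_{j=n-1}^{\min\{k-1,\kappa(n-1)\}}\mathcal{R}(j,n-1).$$ Equivalently (for the same $n$ and $k$), $$\mathcal{R}(k,n)=\mathcal{R}(k-1,n)+\mathcal{R}(k-1,n-1).$$ Moreover, for $n\ge 1$, $$|\mathcal{C}_n|=\sum_{k=n}^{\kappa(n)}\mathcal{R}(k,n).$$
   Context: Let $\kappa(n)=\lfloor n\log_2 3\rfloor$ for $n\ge1$ and $\sigma_n=\kappa(n+1)+1$. For $n\ge1$ let $\mathcal{A}_n$ be the set of integer vectors $\boldsymbol{\alpha}=(\alpha_1,\ldots,\alpha_{n+1})$ with $0=\alpha_1<\alpha_2<\cdots<\alpha_{n+1}$ and $\alpha_{i+1}\le\kappa(i)$ for $1\le i\le n$. For integers $k$ and $n\ge1$ let $\mathcal{R}(k,n)=\#\{\boldsymbol{\alpha}\in\mathcal{A}_n:\alpha_{n+1}=k\}$. Let $T:\mathbb{Z}\to\mathbb{Z}$ be $T(x)=x/2$ for even $x$ and $T(x)=(3x+1)/2$ for odd $x$. The parity vector of length $L$ of an integer $x$ is the $0/1$ vector whose entry at position $s$ ($0\le s\le L-1$) is $1$ iff $T^s(x)$ is odd; it depends only on $x$ mod $2^L$ and gives a bijection $\mathbb{Z}/2^L\mathbb{Z}\to\{0,1\}^L$. For $\boldsymbol{\alpha}\in\mathcal{A}_n$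 let $c(\boldsymbol{\alpha})$ be the unique element of $\{1,\ldots,2^{\sigma_n}-1\}$ whose parity vector of length $\sigma_n$ has ones precisely at positions $\alpha_1,\ldots,\alpha_{n+1}$, and put $\mathcal{C}_n=\{c(\boldsymbol{\alpha}):\boldsymbol{\alpha}\in\mathcal{A}_n\}$. *)

theory Defs
  imports Complex_Main "HOL-Library.FuncSet"
begin

definition kappa :: "nat \<Rightarrow> int" where
  "kappa n = \<lfloor>real n * log 2 3\<rfloor>"

definition sigma :: "nat \<Rightarrow> nat" where
  "sigma n = nat (kappa (n + 1) + 1)"

(* Integer vectors (alpha_1, ..., alpha_(n+1)) are extensional functions on the index set
   {1..n+1}: fixing the value outside the index set makes distinct elements of the set
   distinct as vectors, so that cardinalities are the intended ones. *)
definition A_vecs :: "nat \<Rightarrow> (nat \<Rightarrow> int) set" where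
  "A_vecs n = {\<alpha> \<in> {1..n+1} \<rightarrow>\<^sub>E (UNIV :: int set).
     \<alpha> 1 = 0 \<and>
     (\<forall>i\<in>{1..n}. \<alpha> i < \<alpha> (i + 1)) \<and>
     (\<forall>i\<in>{1..n}. \<alpha> (i + 1) \<le> kappa i)}"

definition R_count :: "int \<Rightarrow> nat \<Rightarrow> nat" where
  "R_count k n = card {\<alpha> \<in> A_vecs n. \<alpha> (n + 1) = k}"

definition T_map :: "int \<Rightarrow> int" where
  "T_map x = (if even x then x div 2 else (3 * x + 1) div 2)"

definition parity_vector :: "nat \<Rightarrow> int \<Rightarrow> nat list" where
  "parity_vector L x = map (\<lambda>s. if odd ((T_map ^^ s) x) then 1 else 0) [0..<L]"

(* The description is proper for alpha in A_vecs n: parity vectors of length L biject with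
   residues mod 2^L, and alpha_1 = 0 excludes the residue 0. *)
definition c_of :: "nat \<Rightarrow> (nat \<Rightarrow> int) \<Rightarrow> int" where
  "c_of n \<alpha> = (THE x. x \<in> {1..2 ^ sigma n - 1} \<and>
     int ` {s. s < sigma n \<and> parity_vector (sigma n) x ! s = 1} = \<alpha> ` {1..n+1})"

definition C_set :: "nat \<Rightarrow> int set" where
  "C_set n = c_of n ` A_vecs n"

end

theory Submission
  imports Defs
begin

text \<open>
  Everything about \<^const>\<open>R_count\<close> comes from deleting the last entry. A vector of length
  \<open>n + 2\<close> with last entry \<open>k\<close> is the same thing as a vector of length \<open>n + 1\<close> with last
  entry at most \<open>k - 1\<close>, as long as \<open>k\<close> respects the upper bound \<open>kappa (n + 1)\<close>; the
  interior constraints are untouched. Hence \<open>R_count k (n + 1)\<close> counts the vectors in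
  \<open>A_vecs n\<close> whose last entry is at most \<open>k - 1\<close> (lemma \<open>R_count_Suc\<close>). Splitting this set
  according to the value of the last entry gives the summation formula, and separating only
  the value \<open>k - 1\<close> from the smaller ones gives the Pascal-type recurrence.

  The formula for the size of \<^const>\<open>C_set\<close> says that \<open>c_of n\<close> is injective on
  \<open>A_vecs n\<close>. The set of odd times before \<open>L\<close> determines an integer modulo \<open>2 ^ L\<close>, because
  one step of \<^const>\<open>T_map\<close> with known parity is affine with slope \<open>1/2\<close> or \<open>3/2\<close>, so it
  loses exactly one factor of \<open>2\<close> in a difference. Since there are as many residues as sets
  of times, each set of times is realised by exactly one residue
  (lemma \<open>ex1_residue_odd_times\<close>). So the definite description defining \<open>c_of n \<alpha>\<close> is
  proper, the value gives back the set of entries of \<open>\<alpha>\<close>, and a strictly increasing vector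
  is determined by its set of entries.
\<close>

section \<open>The admissible vectors\<close>

lemma kappa_0 [simp]: "kappa 0 = 0"
  by (simp add: kappa_def)

lemma kappa_1: "kappa 1 = 1"
proof -
  have "log 2 3 < log 2 (4::real)" by simp
  also have "log 2 (4::real) = 2" using log_pow_cancel[of 2 2] by simp
  finally have "log 2 (3::real) < 2" .
  moreover have "1 \<le> log 2 (3::real)" by simp
  ultimately show ?thesis by (simp add: kappa_def floor_eq_iff)
qed

lemma kappa_mono: "m \<le> n \<Longrightarrow> kappa m \<le> kappa n"
  unfolding kappa_def by (intro floor_mono mult_right_mono) auto

lemma A_vecs_ge:
  assumes "\<alpha> \<in> A_vecs n" "i \<le> n"
  shows "int i \<le> \<alpha> (i + 1)"
  using assms(2)
proof (induction i)
  case 0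
  then show ?case using assms(1) by (simp add: A_vecs_def)
next
  case (Suc i)
  have "\<alpha> (Suc i) < \<alpha> (Suc i + 1)"
    using assms(1) Suc.prems by (simp add: A_vecs_def)
  then show ?case using Suc by simp
qed

lemma A_vecs_le_kappa:
  assumes "\<alpha> \<in> A_vecs n" "i \<le> n"
  shows "\<alpha> (i + 1) \<le> kappa i"
  using assms by (cases "i = 0") (auto simp: A_vecs_def)

lemma A_vecs_strict_mono:
  assumes "\<alpha> \<in> A_vecs n" "1 \<le> i" "i < j" "j \<le> n + 1"
  shows "\<alpha> i < \<alpha> j"
proof -
  have "Suc i \<le> j" using assms by simp
  then show ?thesis
    using assms(4)
  proof (induction j rule: dec_induct)
    case base
    then show ?case using assms by (simp add: A_vecs_def)
  next
    case (step m)
    then have "\<alpha> m < \<alpha> (Suc m)" using assms by (simp add: A_vecs_def)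
    then show ?case using step by simp
  qed
qed

lemma finite_A_vecs: "finite (A_vecs n)"
proof (rule finite_subset)
  show "A_vecs n \<subseteq> {1..n+1} \<rightarrow>\<^sub>E {0..kappa n}"
  proof
    fix \<alpha> assume \<alpha>: "\<alpha> \<in> A_vecs n"
    have "\<alpha> i \<in> {0..kappa n}" if "i \<in> {1..n+1}" for i
    proof -
      have "i = (i - 1) + 1" "i - 1 \<le> n" using that by auto
      then obtain j where "i = j + 1" "j \<le> n" by blast
      then show ?thesis
        using A_vecs_ge[OF \<alpha>, of j] A_vecs_le_kappa[OF \<alpha>, of j] kappa_mono[of j n] by simp
    qed
    then show "\<alpha> \<in> {1..n+1} \<rightarrow>\<^sub>E {0..kappa n}"
      using \<alpha> by (auto simp: A_vecs_def PiE_iff)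
  qed
qed (simp add: finite_PiE)

lemma A_vecs_0: "A_vecs 0 = {\<lambda>i\<in>{1}. 0}"
  by (auto simp: A_vecs_def PiE_iff extensional_def fun_eq_iff)

text \<open>Increasing vectors are recovered by listing the set of entries in order.\<close>

lemma A_vecs_eq_if_same_entries:
  assumes "\<alpha> \<in> A_vecs n" "\<beta> \<in> A_vecs n" "\<alpha> ` {1..n+1} = \<beta> ` {1..n+1}"
  shows "\<alpha> = \<beta>"
proof -
  have sorted: "sorted_wrt (<) (map \<gamma> [1..<n+2])" if "\<gamma> \<in> A_vecs n" for \<gamma>
    using A_vecs_strict_mono[OF that] by (auto simp: sorted_wrt_iff_nth_less simp del: upt_Suc)
  have "{1..<n+2} = {1..n+1}" by auto
  then have "set (map \<alpha> [1..<n+2]) = set (map \<beta> [1..<n+2])"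
    using assms(3) by (simp only: set_map set_upt)
  then have "map \<alpha> [1..<n+2] = map \<beta> [1..<n+2]"
    using sorted[OF assms(1)] sorted[OF assms(2)]
    by (intro sorted_distinct_set_unique) (auto simp only: strict_sorted_iff)
  then have "\<alpha> i = \<beta> i" if "i \<in> {1..n+1}" for i
    using that unfolding map_eq_conv set_upt by simp
  moreover have "\<alpha> \<in> extensional {1..n+1}" "\<beta> \<in> extensional {1..n+1}"
    using assms(1,2) by (auto simp: A_vecs_def PiE_iff)
  ultimately show ?thesis by (intro extensionalityI)
qed

section \<open>Counting by the last entry\<close>

lemma R_count_eq_0:
  assumes "k < int n \<or> k > kappa n"
  shows "R_count k n = 0"
proof -
  have "{\<alpha> \<in> A_vecs n. \<alpha> (n + 1) = k} = {}"
    using assms A_vecs_ge[of _ n n] A_vecs_le_kappa[of _ n n] by force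
  then show ?thesis unfolding R_count_def by (simp only: card.empty)
qed

lemma card_A_vecs_last_le:
  "card {\<alpha> \<in> A_vecs n. \<alpha> (n + 1) \<le> m} = (\<Sum>j = int n..min m (kappa n). R_count j n)"
proof -
  have "{\<alpha> \<in> A_vecs n. \<alpha> (n + 1) \<le> m} =
      (\<Union>j\<in>{int n..min m (kappa n)}. {\<alpha> \<in> A_vecs n. \<alpha> (n + 1) = j})"
    using A_vecs_ge[of _ n n] A_vecs_le_kappa[of _ n n] by auto
  also have "card \<dots> = (\<Sum>j = int n..min m (kappa n). R_count j n)"
    unfolding R_count_def by (rule card_UN_disjoint) (auto simp: finite_A_vecs)
  finally show ?thesis .
qed

text \<open>
  Deleting the last entry \<open>k\<close> is a bijection: what remains satisfies the constraints of
  \<open>A_vecs n\<close>, and conversely appending \<open>k\<close> only requires that \<open>k\<close> exceeds the previous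
  entry, its own upper bound being the hypothesis.
\<close>

lemma R_count_Suc:
  assumes "k \<le> kappa (Suc n)"
  shows "R_count k (Suc n) = card {\<alpha> \<in> A_vecs n. \<alpha> (n + 1) \<le> k - 1}"
proof -
  let ?S = "{\<alpha> \<in> A_vecs (Suc n). \<alpha> (Suc n + 1) = k}"
  let ?P = "{\<alpha> \<in> A_vecs n. \<alpha> (n + 1) \<le> k - 1}"
  \<comment> \<open>Vectors are extensional functions, so deleting the entry at index \<open>n + 2\<close> means
    resetting it to \<^const>\<open>undefined\<close>.\<close>
  have "bij_betw (\<lambda>\<alpha>. \<alpha>(n + 2 := k)) ?P ?S"
  proof (rule bij_betw_byWitness[where f' = "\<lambda>\<alpha>. \<alpha>(n + 2 := undefined)"])
    show "\<forall>\<alpha>\<in>?P. (\<alpha>(n + 2 := k))(n + 2 := undefined) = \<alpha>"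
      by (auto simp: A_vecs_def PiE_iff extensional_def fun_eq_iff)
    show "\<forall>\<alpha>\<in>?S. (\<alpha>(n + 2 := undefined))(n + 2 := k) = \<alpha>"
      by (auto simp: fun_eq_iff)
    show "(\<lambda>\<alpha>. \<alpha>(n + 2 := k)) ` ?P \<subseteq> ?S"
      using assms
      by (auto simp: A_vecs_def PiE_iff extensional_def le_Suc_eq)
    show "(\<lambda>\<alpha>. \<alpha>(n + 2 := undefined)) ` ?S \<subseteq> ?P"
      by (auto simp: A_vecs_def PiE_iff extensional_def)
  qed
  from bij_betw_same_card[OF this] show ?thesis
    unfolding R_count_def by (rule sym)
qed

lemma R_count_Suc_sum:
  assumes "k \<le> kappa (Suc n)"
  shows "R_count k (Suc n) = (\<Sum>j = int n..min (k - 1) (kappa n). R_count j n)"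
  using R_count_Suc[OF assms] card_A_vecs_last_le[of n "k - 1"] by simp

lemma R_count_Suc_pascal:
  assumes "k \<le> kappa (Suc n)"
  shows "R_count k (Suc n) = R_count (k - 1) (Suc n) + R_count (k - 1) n"
proof -
  have k1: "k - 1 \<le> kappa (Suc n)" using assms by simp
  have split: "{\<alpha> \<in> A_vecs n. \<alpha> (n + 1) \<le> k - 1} =
      {\<alpha> \<in> A_vecs n. \<alpha> (n + 1) \<le> k - 1 - 1} \<union> {\<alpha> \<in> A_vecs n. \<alpha> (n + 1) = k - 1}"
    by auto
  have "card {\<alpha> \<in> A_vecs n. \<alpha> (n + 1) \<le> k - 1} =
      card {\<alpha> \<in> A_vecs n. \<alpha> (n + 1) \<le> k - 1 - 1} + card {\<alpha> \<in> A_vecs n. \<alpha> (n + 1) = k - 1}"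
    unfolding split by (rule card_Un_disjoint) (auto simp: finite_A_vecs)
  then show ?thesis
    unfolding R_count_Suc[OF assms] R_count_Suc[OF k1] R_count_def[of "k - 1" n] .
qed

lemma R_count_1_1: "R_count 1 1 = 1"
proof -
  have "{\<alpha> \<in> A_vecs 0. \<alpha> (0 + 1) \<le> (1::int) - 1} = A_vecs 0"
    using A_vecs_le_kappa[of _ 0 0] by auto
  moreover have "R_count 1 (Suc 0) = card {\<alpha> \<in> A_vecs 0. \<alpha> (0 + 1) \<le> (1::int) - 1}"
    using kappa_1 by (intro R_count_Suc) simp
  ultimately show ?thesis by (simp only: A_vecs_0 One_nat_def) simp
qed

section \<open>Parity vectors and residues\<close>

definition odd_times :: "nat \<Rightarrow> int \<Rightarrow> nat set" where
  "odd_times L x = {s. s < L \<and> odd ((T_map ^^ s) x)}"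

lemma parity_vector_odd_times:
  "{s. s < L \<and> parity_vector L x ! s = 1} = odd_times L x"
  by (auto simp: parity_vector_def odd_times_def split: if_splits)

text \<open>
  Two integers of equal parity satisfy \<open>2 * (T x - T y) = c * (x - y)\<close> with \<open>c\<close> odd, so a
  factor \<open>2 ^ L\<close> of \<open>T x - T y\<close>, given by induction because dropping time \<open>0\<close> shifts
  the odd times of \<open>x\<close> to those of \<open>T x\<close>, yields a factor \<open>2 ^ Suc L\<close> of \<open>x - y\<close>.
\<close>

lemma odd_times_eq_imp_dvd:
  "odd_times L x = odd_times L y \<Longrightarrow> 2 ^ L dvd x - y"
proof (induction L arbitrary: x y)
  case 0
  then show ?case by simp
next
  case (Suc L)
  have mem: "odd ((T_map ^^ s) x) \<longleftrightarrow> odd ((T_map ^^ s) y)" if "s < Suc L" for s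
    using Suc.prems that unfolding odd_times_def by blast
  have "odd_times L (T_map x) = odd_times L (T_map y)"
    using mem[of "Suc s" for s]
    by (auto simp: odd_times_def funpow_Suc_right simp del: funpow.simps)
  then have "2 ^ L dvd T_map x - T_map y" by (rule Suc.IH)
  then have dvd: "2 ^ Suc L dvd 2 * (T_map x - T_map y)"
    unfolding power_Suc by (rule mult_dvd_mono[OF dvd_refl])
  have par: "odd x \<longleftrightarrow> odd y" using mem[of 0] by simp
  show ?case
  proof (cases "even x")
    case True
    then have "x - y = 2 * (T_map x - T_map y)" using par by (simp add: T_map_def)
    then show ?thesis using dvd by (simp only:)
  next
    case False
    have T_odd: "2 * T_map z = 3 * z + 1" if "odd z" for z
    proof -
      have "even (3 * z + 1)" using that by simp
      then have "2 * ((3 * z + 1) div 2) = 3 * z + 1" by (rule dvd_mult_div_cancel)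
      then show ?thesis using that by (simp only: T_map_def if_False)
    qed
    have "2 * T_map x = 3 * x + 1" "2 * T_map y = 3 * y + 1"
      using False par by (simp_all only: T_odd not_False_eq_True)
    then have "3 * (x - y) = 2 * (T_map x - T_map y)" by (simp add: algebra_simps)
    then have "2 ^ Suc L dvd 3 * (x - y)" using dvd by (simp only:)
    moreover have "coprime (2 ^ Suc L :: int) 3"
      by (simp only: coprime_power_left_iff) simp
    ultimately show ?thesis by (simp only: coprime_dvd_mult_right_iff)
  qed
qed

lemma inj_on_odd_times: "inj_on (odd_times L) {0..<2 ^ L}"
proof (rule inj_onI)
  fix x y :: int
  assume xy: "x \<in> {0..<2 ^ L}" "y \<in> {0..<2 ^ L}" and "odd_times L x = odd_times L y"
  then have "x mod 2 ^ L = y mod 2 ^ L"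
    by (simp only: mod_eq_dvd_iff odd_times_eq_imp_dvd)
  then show "x = y" using xy by (simp add: mod_pos_pos_trivial)
qed

text \<open>Surjectivity is free: there are \<open>2 ^ L\<close> residues and \<open>2 ^ L\<close> sets of times.\<close>

lemma ex1_residue_odd_times:
  assumes "S \<subseteq> {..<L}"
  shows "\<exists>!x. x \<in> {0..<2 ^ L} \<and> odd_times L x = S"
proof -
  have "odd_times L ` {0..<2 ^ L} = Pow {..<L}"
  proof (rule card_subset_eq)
    show "odd_times L ` {0..<2 ^ L} \<subseteq> Pow {..<L}" by (auto simp: odd_times_def)
    show "card (odd_times L ` {0..<2 ^ L}) = card (Pow {..<L})"
      by (simp add: card_image inj_on_odd_times card_Pow nat_power_eq)
  qed simp
  then have "S \<in> odd_times L ` {0..<2 ^ L}" using assms by simp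
  then show ?thesis using inj_onD[OF inj_on_odd_times[of L]] by blast
qed

section \<open>The residues attached to the admissible vectors\<close>

lemma A_vecs_entries_bounds:
  assumes "\<alpha> \<in> A_vecs n" "v \<in> \<alpha> ` {1..n+1}"
  shows "0 \<le> v" "v < int (sigma n)"
proof -
  from assms(2) obtain i where i: "i \<le> n" "v = \<alpha> (i + 1)"
    by (force simp: image_iff Suc_le_eq gr0_conv_Suc)
  have "int i \<le> v" "v \<le> kappa (n + 1)"
    using A_vecs_ge[OF assms(1) i(1)] A_vecs_le_kappa[OF assms(1) i(1)]
      kappa_mono[of i "n + 1"] i by simp_all
  then show "0 \<le> v" "v < int (sigma n)" by (simp_all add: sigma_def)
qed

text \<open>
  The range \<open>{1..2 ^ sigma n - 1}\<close> omits the residue \<open>0\<close>; nothing is lost, because the entry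
  \<open>0\<close> of \<open>\<alpha>\<close> forces the residue to be odd.
\<close>

lemma odd_times_c_of:
  assumes "\<alpha> \<in> A_vecs n"
  shows "int ` odd_times (sigma n) (c_of n \<alpha>) = \<alpha> ` {1..n+1}"
proof -
  let ?E = "\<alpha> ` {1..n+1}"
  let ?S = "nat ` ?E"
  have ES: "int ` ?S = ?E"
    using A_vecs_entries_bounds(1)[OF assms] by (force simp: image_image)
  have "0 \<in> ?E"
    using assms by (intro image_eqI[of _ _ 1]) (auto simp: A_vecs_def)
  then have "0 \<in> ?S" by force
  have "?S \<subseteq> {..<sigma n}"
    using A_vecs_entries_bounds[OF assms] by fastforce
  from ex1_residue_odd_times[OF this]
  have ex1: "\<exists>!x. x \<in> {0..<2 ^ sigma n} \<and> odd_times (sigma n) x = ?S" .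
  have same: "x \<in> {1..2 ^ sigma n - 1} \<and> int ` odd_times (sigma n) x = ?E \<longleftrightarrow>
      x \<in> {0..<2 ^ sigma n} \<and> odd_times (sigma n) x = ?S" for x
  proof -
    have "int ` odd_times (sigma n) x = ?E \<longleftrightarrow> odd_times (sigma n) x = ?S"
      using ES by (metis inj_image_eq_iff inj_of_nat)
    moreover have "x \<noteq> 0" if "odd_times (sigma n) x = ?S"
    proof -
      have "0 \<in> odd_times (sigma n) x" using that \<open>0 \<in> ?S\<close> by simp
      then show ?thesis by (auto simp: odd_times_def)
    qed
    ultimately show ?thesis by auto
  qed
  have "c_of n \<alpha> = (THE x. x \<in> {0..<2 ^ sigma n} \<and> odd_times (sigma n) x = ?S)"
    unfolding c_of_def parity_vector_odd_times same ..
  then have "odd_times (sigma n) (c_of n \<alpha>) = ?S" using theI'[OF ex1] by simp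
  then show ?thesis using ES by simp
qed

lemma inj_on_c_of: "inj_on (c_of n) (A_vecs n)"
  by (rule inj_onI) (metis A_vecs_eq_if_same_entries odd_times_c_of)

lemma card_C_set: "card (C_set n) = (\<Sum>k = int n..kappa n. R_count k n)"
proof -
  have "{\<alpha> \<in> A_vecs n. \<alpha> (n + 1) \<le> kappa n} = A_vecs n"
    using A_vecs_le_kappa[of _ n n] by auto
  then have "card (A_vecs n) = (\<Sum>k = int n..kappa n. R_count k n)"
    using card_A_vecs_last_le[of n "kappa n"] by simp
  then show ?thesis by (simp add: C_set_def card_image inj_on_c_of)
qed

theorem proposition8:
  shows "R_count 1 1 = 1 \<and>
    (\<forall>(n::nat) (k::int). n \<ge> 1 \<and> (k < int n \<or> k > kappa n) \<longrightarrow> R_count k n = 0) \<and>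
    (\<forall>(n::nat) (k::int). n \<ge> 2 \<and> int n \<le> k \<and> k \<le> kappa n \<longrightarrow>
       R_count k n = (\<Sum>j = int n - 1..min (k - 1) (kappa (n - 1)). R_count j (n - 1))) \<and>
    (\<forall>(n::nat) (k::int). n \<ge> 2 \<and> int n \<le> k \<and> k \<le> kappa n \<longrightarrow>
       R_count k n = R_count (k - 1) n + R_count (k - 1) (n - 1)) \<and>
    (\<forall>n::nat. n \<ge> 1 \<longrightarrow> card (C_set n) = (\<Sum>k = int n..kappa n. R_count k n))"
proof (intro conjI allI impI)
  fix n :: nat and k :: int
  assume nk: "n \<ge> 2 \<and> int n \<le> k \<and> k \<le> kappa n"
  then obtain m where m: "n = Suc m" by (cases n) auto
  show "R_count k n = (\<Sum>j = int n - 1..min (k - 1) (kappa (n - 1)). R_count j (n - 1))"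
    using R_count_Suc_sum[of k m] nk m by simp
  show "R_count k n = R_count (k - 1) n + R_count (k - 1) (n - 1)"
    using R_count_Suc_pascal[of k m] nk m by simp
qed (use R_count_1_1 R_count_eq_0 card_C_set in auto)

end
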